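(* Let $n\ge 6$ be an integer and let $\Delta_n$ be the graph defined in the context. Then the metric dimension of $\Delta_n$ is $3$, i.e. $\dim(\Delta_n)=3$.
   Context: All indices are taken modulo $n$ (so $p_{n+1}=p_1$, etc.). The heptagonal circular ladder $\Gamma_n$ is the graph with vertex set $\{p_t,q_t,r_t,s_t : 1\le t\le n\}$ ($4n$ vertices) and edge set $\{p_tp_{t+1},\ p_tq_t,\ q_tr_t,\ r_ts_t,\ s_tr_{t+1} : 1\le t\le n\}$ ($5n$ edges); thus the $p_t$ form an $n$-cycle, the $r_t,s_t$ form a $2n$-cycle $r_1s_1r_2s_2\cdots r_ns_n$, and the faces $p_tp_{t+1}q_{t+1}r_{t+1}s_tr_tq_t$ are heptagons. The graph $\Delta_n$ has the same vertex set as $\Gamma_n$ and edge set $E(\Gamma_n)\cup\{r_tq_{t+1}:1\le t\le n\}$ ($6n$ edges). For a connected graph $G$ with distance $d$, a set $Y\subseteq V(G)$ is a resolving set if for every two distinct vertices $u,v$ there is $y\in Y$ with $d(y,u)\ne d(y,v)$; the metric dimension $\dim(G)$ is the minimum cardinality of a resolving set. *)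

theory Defs
  imports "Graph_Theory.Graph_Theory"
begin

text \<open>
  Undirected graphs are modelled as symmetric digraphs (as in locale \<open>pair_graph\<close>), and
  distances are shortest-path lengths, i.e. shortest-path costs where every arc has weight 1.
\<close>

definition graph_dist :: "('a, 'b) pre_digraph \<Rightarrow> 'a \<Rightarrow> 'a \<Rightarrow> ereal" where
  "graph_dist G u v = wf_digraph.\<mu> G (\<lambda>_. 1) u v"

definition resolving_set :: "('a, 'b) pre_digraph \<Rightarrow> 'a set \<Rightarrow> bool" where
  "resolving_set G Y \<longleftrightarrow> Y \<subseteq> verts G \<and>
     (\<forall>u\<in>verts G. \<forall>v\<in>verts G. u \<noteq> v \<longrightarrow> (\<exists>y\<in>Y. graph_dist G y u \<noteq> graph_dist G y v))"

text \<open>Intended for finite connected graphs, where the whole vertex set is resolving.\<close>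

definition metric_dim :: "('a, 'b) pre_digraph \<Rightarrow> nat" where
  "metric_dim G = (LEAST k. \<exists>Y. finite Y \<and> resolving_set G Y \<and> card Y = k)"

datatype vertex = P nat | Q nat | R nat | S nat

text \<open>
  The index set is taken to be the residues \<open>0, \<dots>, n - 1\<close> modulo \<open>n\<close>, with residue \<open>0\<close>
  in the role of the index \<open>n\<close>.
\<close>

definition ladder_verts :: "nat \<Rightarrow> vertex set" where
  "ladder_verts n = (\<Union>t<n. {P t, Q t, R t, S t})"

definition gamma_edges :: "nat \<Rightarrow> (vertex \<times> vertex) set" where
  "gamma_edges n = (\<Union>t<n. {(P t, P (Suc t mod n)), (P t, Q t), (Q t, R t),
                            (R t, S t), (S t, R (Suc t mod n))})"

definition delta_edges :: "nat \<Rightarrow> (vertex \<times> vertex) set" where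
  "delta_edges n = gamma_edges n \<union> (\<Union>t<n. {(R t, Q (Suc t mod n))})"

text \<open>Each edge is listed above in one orientation; the graph contains both arcs.\<close>

definition Delta :: "nat \<Rightarrow> vertex pair_pre_digraph" where
  "Delta n = \<lparr> pverts = ladder_verts n, parcs = delta_edges n \<union> (delta_edges n)\<inverse> \<rparr>"

text \<open>
  The library's shortest-path function is only meaningful on well-formed digraphs, and the
  metric dimension only on finite connected graphs; both conditions hold here.
\<close>

lemma Suc_mod_neq: "2 \<le> n \<Longrightarrow> t < n \<Longrightarrow> Suc t mod n \<noteq> t"
  by (cases "Suc t = n") auto

lemma pair_graph_Delta:
  assumes "2 \<le> n"
  shows "pair_graph (Delta n)"
proof -
  have m: "Suc t mod n < n" for t using assms by simp
  have sub: "delta_edges n \<subseteq> ladder_verts n \<times> ladder_verts n"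
    using m unfolding delta_edges_def gamma_edges_def ladder_verts_def by auto
  have irr: "u \<noteq> v" if "(u, v) \<in> delta_edges n" for u v
    using that Suc_mod_neq[OF assms] unfolding delta_edges_def gamma_edges_def by fastforce
  have fV: "finite (ladder_verts n)" unfolding ladder_verts_def by simp
  have fE: "finite (delta_edges n)" using sub fV finite_subset by blast
  show ?thesis
  proof
    show "symmetric (with_proj (Delta n))"
      unfolding symmetric_def Delta_def by (auto intro!: symI)
  next
    fix e assume "e \<in> parcs (Delta n)"
    then show "fst e \<noteq> snd e" using irr unfolding Delta_def by (cases e) fastforce
  qed (use sub fV fE in \<open>auto simp: Delta_def\<close>)
qed

lemma strongly_connected_Delta:
  assumes "2 \<le> n"
  shows "strongly_connected (with_proj (Delta n))"
proof -
  interpret pair_graph "Delta n" using pair_graph_Delta[OF assms] .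
  let ?D = "with_proj (Delta n)"
  have adj: "u \<rightarrow>\<^sup>*\<^bsub>?D\<^esub> v" if "(u, v) \<in> delta_edges n" for u v
    using that by (intro reachable_adjI) (simp add: Delta_def)
  have sr: "u \<rightarrow>\<^sup>*\<^bsub>?D\<^esub> v" if "v \<rightarrow>\<^sup>*\<^bsub>?D\<^esub> u" for u v
    using that sym_arcs by (rule symmetric_reachable[rotated])
  have p: "P 0 \<rightarrow>\<^sup>*\<^bsub>?D\<^esub> P t" if "t < n" for t
    using that
  proof (induction t)
    case 0
    then show ?case using assms by (intro reachable_refl) (auto simp: Delta_def ladder_verts_def)
  next
    case (Suc t)
    then have "(P t, P (Suc t)) \<in> delta_edges n"
      by (auto simp: delta_edges_def gamma_edges_def intro!: bexI[of _ t])
    with Suc adj show ?case by (meson Suc_lessD reachable_trans)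
  qed
  have pq: "P 0 \<rightarrow>\<^sup>*\<^bsub>?D\<^esub> Q t" if "t < n" for t
    using p[OF that] adj[of "P t" "Q t"] that
    by (auto simp: delta_edges_def gamma_edges_def intro: reachable_trans)
  have pr: "P 0 \<rightarrow>\<^sup>*\<^bsub>?D\<^esub> R t" if "t < n" for t
    using pq[OF that] adj[of "Q t" "R t"] that
    by (auto simp: delta_edges_def gamma_edges_def intro: reachable_trans)
  have ps: "P 0 \<rightarrow>\<^sup>*\<^bsub>?D\<^esub> S t" if "t < n" for t
    using pr[OF that] adj[of "R t" "S t"] that
    by (auto simp: delta_edges_def gamma_edges_def intro: reachable_trans)
  have V: "pverts (Delta n) = ladder_verts n" by (simp add: Delta_def)
  have all: "P 0 \<rightarrow>\<^sup>*\<^bsub>?D\<^esub> v" if "v \<in> pverts (Delta n)" for v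
    using that p pq pr ps unfolding V ladder_verts_def by auto
  have "pverts (Delta n) \<noteq> {}" using assms unfolding V ladder_verts_def by (auto intro: exI[of _ 0])
  moreover have "u \<rightarrow>\<^sup>*\<^bsub>?D\<^esub> v"
    if "u \<in> pverts (Delta n)" "v \<in> pverts (Delta n)" for u v
    using reachable_trans[OF sr[OF all[OF that(1)]] all[OF that(2)]] .
  ultimately show ?thesis unfolding strongly_connected_def by simp
qed

end

theory Submission
  imports Defs
begin

text \<open>
  Every distance in \<open>Delta n\<close> has a closed form, since a shortest path only has to decide on the
  sense of rotation and on whether to descend to the cycle of the \<open>P t\<close>. The closed form is
  certified as the distance from \<open>y\<close> by being \<open>0\<close> only at \<open>y\<close>, changing by at most one along an
  edge, and decreasing along some edge at every other vertex.

  The vertices \<open>P 0\<close>, \<open>P 2\<close>, \<open>P (n div 2)\<close> resolve: the differences of the three distances tell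
  on which arc a vertex lies, and the distances then give its type and index. For two vertices,
  the rotation symmetry moves the first one to index \<open>0\<close>; depending on the two types and on the
  index \<open>b\<close> of the second vertex, an unresolved pair is found near one of the two vertices.
\<close>

section \<open>Distances determined by a potential\<close>

context wf_digraph
begin

lemma length_awalk_ge_potential:
  fixes f :: "'a \<Rightarrow> nat"
  assumes lip: "\<And>e. e \<in> arcs G \<Longrightarrow> f (head G e) \<le> Suc (f (tail G e))"
    and "awalk u p v"
  shows "f v \<le> f u + length p"
  using assms(2)
proof (induction p arbitrary: u)
  case Nil
  then show ?case by (simp add: awalk_Nil_iff)
next
  case (Cons e p)
  then have "e \<in> arcs G" "tail G e = u" "awalk (head G e) p v"
    by (auto simp: awalk_Cons_iff)
  with Cons.IH[of "head G e"] lip[of e] show ?case by simp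
qed

text \<open>The walk is built from its far end: the descent at \<open>v\<close> supplies the last
  arc, and induction on the value supplies a walk to the tail of that arc.\<close>

lemma awalk_of_potential:
  fixes f :: "'a \<Rightarrow> nat"
  assumes y: "y \<in> verts G" "\<And>v. v \<in> verts G \<Longrightarrow> f v = 0 \<Longrightarrow> v = y"
    and desc: "\<And>v. v \<in> verts G \<Longrightarrow> 0 < f v \<Longrightarrow>
      \<exists>e\<in>arcs G. head G e = v \<and> f v = Suc (f (tail G e))"
    and "v \<in> verts G"
  shows "\<exists>p. awalk y p v \<and> length p = f v"
  using assms(4)
proof (induction "f v" arbitrary: v)
  case 0
  then show ?case using y by (auto simp: awalk_Nil_iff intro!: exI[of _ "[]"])
next
  case (Suc d)
  then obtain e where e: "e \<in> arcs G" "head G e = v" "f v = Suc (f (tail G e))"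
    using desc[of v] by auto
  then obtain p where "awalk y p (tail G e)" "length p = f (tail G e)"
    using Suc by fastforce
  moreover have "awalk (tail G e) [e] v"
    using e by (auto simp: awalk_Cons_iff awalk_Nil_iff)
  ultimately show ?case using e(3) by (auto intro!: exI[of _ "p @ [e]"])
qed

lemma graph_dist_eq_potential:
  fixes f :: "'a \<Rightarrow> nat"
  assumes "y \<in> verts G" "f y = 0" "\<And>v. v \<in> verts G \<Longrightarrow> f v = 0 \<Longrightarrow> v = y"
    and lip: "\<And>e. e \<in> arcs G \<Longrightarrow> f (head G e) \<le> Suc (f (tail G e))"
    and "\<And>v. v \<in> verts G \<Longrightarrow> 0 < f v \<Longrightarrow>
      \<exists>e\<in>arcs G. head G e = v \<and> f v = Suc (f (tail G e))"
    and "v \<in> verts G"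
  shows "graph_dist G y v = ereal (f v)"
proof -
  have cost: "awalk_cost (\<lambda>_. 1) p = real (length p)" for p :: "'b awalk"
    by (induction p) auto
  obtain p where p: "awalk y p v" "length p = f v"
    using awalk_of_potential[of y f v] assms by blast
  show ?thesis unfolding graph_dist_def
  proof (rule antisym)
    show "\<mu> (\<lambda>_. 1) y v \<le> ereal (f v)"
      using min_cost_le_walk_cost[OF p(1), of "\<lambda>_. 1"] p(2) by (simp add: cost)
    show "ereal (f v) \<le> \<mu> (\<lambda>_. 1) y v"
      unfolding \<mu>_def using length_awalk_ge_potential[of f y _ v, OF lip] assms(2)
      by (auto intro!: INF_greatest simp: cost)
  qed
qed

end

section \<open>Distances in the graph\<close>

text \<open>For indices below \<open>n\<close> this is \<open>j - i\<close> modulo \<open>n\<close>.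
  Here and in \<open>nxt\<close> and \<open>prv\<close>, case distinctions replace
  \<open>mod\<close> to keep goals linear.\<close>

definition off :: "nat \<Rightarrow> nat \<Rightarrow> nat \<Rightarrow> nat" where
  "off n i j = (if i \<le> j then j - i else j + n - i)"

definition nxt :: "nat \<Rightarrow> nat \<Rightarrow> nat" where
  "nxt n t = (if Suc t = n then 0 else Suc t)"

definition prv :: "nat \<Rightarrow> nat \<Rightarrow> nat" where
  "prv n t = (if t = 0 then n - 1 else t - 1)"

text \<open>
  The cyclic distance between two blocks of consecutive indices, of lengths \<open>a + 1\<close> and
  \<open>b + 1\<close> and with starting points \<open>k\<close> apart. Truncated subtraction gives \<open>0\<close> when they overlap.
\<close>

definition gap :: "nat \<Rightarrow> nat \<Rightarrow> nat \<Rightarrow> nat \<Rightarrow> nat" where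
  "gap n a b k = min (k - a) (n - b - k)"

text \<open>
  Moving \<open>e\<close> indices along the cycle through the \<open>Q t\<close> and \<open>R t\<close> costs \<open>2 * e\<close>; along the cycle
  of the \<open>P t\<close> it costs \<open>e\<close>, plus the detour to get there.
\<close>

definition short2 :: "nat \<Rightarrow> nat" where
  "short2 e = min (2 * e) (e + 2)"

definition short3 :: "nat \<Rightarrow> nat" where
  "short3 e = min (2 * e) (e + 3)"

text \<open>Towards P and Q vertices, \<open>R j\<close> stands over the indices \<open>j\<close>,
  \<open>j + 1\<close> and \<open>S j\<close> over \<open>j\<close>, \<open>j + 1\<close>,
  \<open>j + 2\<close>; these are the blocks in \<open>gap\<close>, and the constants count the
  climbs. Among R and S vertices the blocks consist of R indices: the detour over the P cycle costs
  four steps but saves one index, hence \<open>short3\<close>.\<close>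

fun vdist :: "nat \<Rightarrow> vertex \<Rightarrow> vertex \<Rightarrow> nat" where
  "vdist n (P i) (P j) = gap n 0 0 (off n i j)"
| "vdist n (P i) (Q j) = 1 + gap n 0 0 (off n i j)"
| "vdist n (P i) (R j) = 2 + gap n 0 1 (off n i j)"
| "vdist n (P i) (S j) = 3 + gap n 0 2 (off n i j)"
| "vdist n (Q i) (P j) = 1 + gap n 0 0 (off n i j)"
| "vdist n (Q i) (Q j) = short2 (gap n 0 0 (off n i j))"
| "vdist n (Q i) (R j) = 1 + short2 (gap n 0 1 (off n i j))"
| "vdist n (Q i) (S j) = 2 + short2 (gap n 0 2 (off n i j))"
| "vdist n (R i) (P j) = 2 + gap n 1 0 (off n i j)"
| "vdist n (R i) (Q j) = 1 + short2 (gap n 1 0 (off n i j))"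
| "vdist n (R i) (R j) = short3 (gap n 0 0 (off n i j))"
| "vdist n (R i) (S j) = 1 + short3 (gap n 0 1 (off n i j))"
| "vdist n (S i) (P j) = 3 + gap n 2 0 (off n i j)"
| "vdist n (S i) (Q j) = 2 + short2 (gap n 2 0 (off n i j))"
| "vdist n (S i) (R j) = 1 + short3 (gap n 1 0 (off n i j))"
| "vdist n (S i) (S j) =
     (if i = j then 0 else 2 + short3 (gap n 1 1 (off n i j)))"

fun idx :: "vertex \<Rightarrow> nat" where
  "idx (P i) = i" | "idx (Q i) = i" | "idx (R i) = i" | "idx (S i) = i"

lemma mem_ladder_verts [simp]: "v \<in> ladder_verts n \<longleftrightarrow> idx v < n"
  by (cases v) (auto simp: ladder_verts_def)

text \<open>This rotation takes index \<open>i\<close> to \<open>0\<close>; its inverse is the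
  rotation by \<open>off n i 0\<close>.\<close>

fun shift :: "nat \<Rightarrow> nat \<Rightarrow> vertex \<Rightarrow> vertex" where
  "shift n i (P j) = P (off n i j)"
| "shift n i (Q j) = Q (off n i j)"
| "shift n i (R j) = R (off n i j)"
| "shift n i (S j) = S (off n i j)"

lemma off_0 [simp]: "off n 0 j = j" and off_self [simp]: "off n i i = 0"
  by (simp_all add: off_def)

lemma off_less: "i < n \<Longrightarrow> j < n \<Longrightarrow> off n i j < n"
  by (auto simp: off_def)

lemma off_off: "i < n \<Longrightarrow> j < n \<Longrightarrow> k < n \<Longrightarrow> off n (off n i j) (off n i k) = off n j k"
  by (auto simp: off_def)

lemma off_eq_iff: "i < n \<Longrightarrow> j < n \<Longrightarrow> k < n \<Longrightarrow> off n i j = off n i k \<longleftrightarrow> j = k"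
  by (auto simp: off_def)

lemma off_nxt: "i < n \<Longrightarrow> t < n \<Longrightarrow> off n i (nxt n t) = nxt n (off n i t)"
  by (auto simp: off_def nxt_def)

lemma nxt_less: "t < n \<Longrightarrow> nxt n t < n" and prv_less: "t < n \<Longrightarrow> prv n t < n"
  and nxt_prv: "t < n \<Longrightarrow> nxt n (prv n t) = t"
  by (auto simp: nxt_def prv_def)

lemma idx_shift [simp]: "idx (shift n i v) = off n i (idx v)"
  by (cases v) auto

lemma vdist_shift:
  "i < n \<Longrightarrow> idx y < n \<Longrightarrow> idx v < n \<Longrightarrow> vdist n (shift n i y) (shift n i v) = vdist n y v"
  by (cases y; cases v) (simp_all add: off_off off_eq_iff)

lemma shift_inverse:
  assumes "i < n" "idx v < n"
  shows "shift n (off n i 0) (shift n i v) = v"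
  using assms off_off[of i n 0 "idx v"] by (cases v) auto

lemma shift_eq_iff:
  "i < n \<Longrightarrow> idx u < n \<Longrightarrow> idx v < n \<Longrightarrow> shift n i u = shift n i v \<longleftrightarrow> u = v"
  by (metis shift_inverse)

section \<open>Adjacency and its invariance under rotation\<close>

definition edges_at :: "nat \<Rightarrow> nat \<Rightarrow> (vertex \<times> vertex) set" where
  "edges_at n t = {(P t, P (nxt n t)), (P t, Q t), (Q t, R t), (R t, S t), (S t, R (nxt n t)),
     (R t, Q (nxt n t))}"

lemma delta_edges_eq: "delta_edges n = (\<Union>t<n. edges_at n t)"
proof -
  have "Suc t mod n = nxt n t" if "t < n" for t
    using that by (cases "Suc t = n") (auto simp: nxt_def)
  then show ?thesis
    by (auto simp: delta_edges_def gamma_edges_def edges_at_def)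
qed

lemma edges_at_subset: "t < n \<Longrightarrow> edges_at n t \<subseteq> delta_edges n"
  by (auto simp: delta_edges_eq)

definition adj :: "nat \<Rightarrow> vertex \<Rightarrow> vertex \<Rightarrow> bool" where
  "adj n u v \<longleftrightarrow> (u, v) \<in> delta_edges n \<or> (v, u) \<in> delta_edges n"

lemma shift_edges_at:
  "i < n \<Longrightarrow> t < n \<Longrightarrow> (u, v) \<in> edges_at n t \<Longrightarrow>
    (shift n i u, shift n i v) \<in> edges_at n (off n i t)"
  by (auto simp: edges_at_def off_nxt)

lemma adj_iff: "adj n u v \<longleftrightarrow> (\<exists>t<n. (u, v) \<in> edges_at n t \<or> (v, u) \<in> edges_at n t)"
  by (auto simp: adj_def delta_edges_eq)

lemma adj_shift:
  assumes "i < n" "adj n u v"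
  shows "adj n (shift n i u) (shift n i v)"
proof -
  obtain t where "t < n" "(u, v) \<in> edges_at n t \<or> (v, u) \<in> edges_at n t"
    using assms(2) adj_iff by blast
  then show ?thesis
    using shift_edges_at[OF assms(1)] off_less[OF assms(1)] adj_iff by blast
qed

lemma adj_idx_less: "adj n u v \<Longrightarrow> idx u < n \<and> idx v < n"
  by (auto simp: adj_def delta_edges_eq edges_at_def nxt_less)

lemma adj_at:
  assumes "t < n"
  shows "adj n (P (nxt n t)) (P t)" "adj n (P (prv n t)) (P t)" "adj n (Q t) (P t)"
    "adj n (P t) (Q t)" "adj n (R t) (Q t)" "adj n (R (prv n t)) (Q t)"
    "adj n (Q t) (R t)" "adj n (Q (nxt n t)) (R t)" "adj n (S t) (R t)" "adj n (S (prv n t)) (R t)"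
    "adj n (R t) (S t)" "adj n (R (nxt n t)) (S t)"
  using edges_at_subset[OF assms] edges_at_subset[OF prv_less[OF assms]]
  by (auto simp: adj_def edges_at_def nxt_prv[OF assms])

lemmas dist_defs = gap_def short2_def short3_def min_def

lemma vdist_self [simp]: "vdist n v v = 0"
  by (cases v) (auto simp: dist_defs)

lemma vdist_eq_0:
  assumes "idx u < n" "idx v < n" "vdist n u v = 0"
  shows "v = u"
  using off_less[OF assms(1,2)] off_eq_iff[OF assms(1,2,1)] assms(3)
  by (cases u; cases v) (auto simp: dist_defs split: if_splits)

text \<open>Writing \<open>n\<close> and \<open>k\<close> as sums keeps truncated subtraction out of the goals.\<close>

lemma index_cases:
  fixes k n :: nat
  assumes "6 \<le> n" "k < n"
  obtains (far) i j where "k = i + 5" "n = i + j + 10"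
    | (near) m where "n = m + 6" "k \<in> {0, 1, 2, 3, 4, m + 5, m + 4, m + 3, m + 2}"
proof (cases "5 \<le> k \<and> k + 5 \<le> n")
  case True
  then have "k = (k - 5) + 5" "n = (k - 5) + (n - k - 5) + 10" by auto
  then show ?thesis by (rule far)
next
  case False
  obtain m where m: "n = m + 6" using assms(1) by (metis le_add_diff_inverse2)
  have "5 \<le> k \<or> k = 0 \<or> k = 1 \<or> k = 2 \<or> k = 3 \<or> k = 4" by presburger
  moreover have "k + 5 \<le> n \<or> k = m + 5 \<or> k = m + 4 \<or> k = m + 3 \<or> k = m + 2"
    using assms(2) m by presburger
  ultimately show ?thesis using False near[OF m] by blast
qed

section \<open>The closed form as a potential\<close>

lemma vdist_edge_0:
  assumes "6 \<le> n" "k < n" "y \<in> {P 0, Q 0, R 0, S 0}" "(u, v) \<in> edges_at n k"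
  shows "vdist n y u \<le> Suc (vdist n y v) \<and> vdist n y v \<le> Suc (vdist n y u)"
  using assms(1,2)
proof (cases rule: index_cases)
  \<comment> \<open>Five indices from \<open>0\<close> on either side, the gaps at \<open>k\<close>
    and at its neighbouring indices are so large that the detour over the P cycle is never longer
    than the direct route.\<close>
  case (far i j)
  with assms(3,4) show ?thesis by (auto simp: edges_at_def nxt_def dist_defs)
next
  case (near m)
  with assms(3,4) show ?thesis by (auto simp: edges_at_def nxt_def dist_defs)
qed

lemma vdist_adj:
  assumes "6 \<le> n" "idx y < n" "adj n u v"
  shows "vdist n y v \<le> Suc (vdist n y u)"
proof -
  define s where "s = shift n (idx y)"
  have "s y \<in> {P 0, Q 0, R 0, S 0}" unfolding s_def by (cases y) auto
  moreover obtain t where "t < n" "(s u, s v) \<in> edges_at n t \<or> (s v, s u) \<in> edges_at n t"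
    using adj_shift[OF assms(2,3)] by (auto simp: s_def adj_def delta_edges_eq)
  ultimately have "vdist n (s y) (s v) \<le> Suc (vdist n (s y) (s u))"
    using vdist_edge_0[OF assms(1)] by blast
  then show ?thesis
    using vdist_shift[OF assms(2,2)] adj_idx_less[OF assms(3)] by (simp add: s_def)
qed

text \<open>A shortest path to a far vertex can follow the P cycle and climb at the end, so the far
  cases step back along that cycle at \<open>P k\<close> and one level down at \<open>Q k\<close>,
  \<open>R k\<close>, \<open>S k\<close>. The remaining neighbours enter only near index
  \<open>0\<close>.\<close>

lemma vdist_descent_P:
  assumes n: "6 \<le> n" and k: "k < n" and y: "y \<in> {P 0, Q 0, R 0, S 0}"
    and pos: "0 < vdist n y (P k)"
  shows "\<exists>w. adj n w (P k) \<and> vdist n y (P k) = Suc (vdist n y w)"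
proof -
  let ?ok = "\<lambda>w. vdist n y (P k) = Suc (vdist n y w)"
  have "?ok (P (nxt n k)) \<or> ?ok (P (prv n k)) \<or> ?ok (Q k)"
    using n k
  proof (cases rule: index_cases)
    case (far i j)
    then have "?ok (P (nxt n k)) \<or> ?ok (P (prv n k))"
      using y by (elim insertE emptyE; simp add: nxt_def prv_def dist_defs)
    then show ?thesis by blast
  next
    case (near m)
    with pos y show ?thesis
      by (elim insertE emptyE; simp add: nxt_def prv_def dist_defs split: if_splits; linarith?)
  qed
  then show ?thesis using adj_at[OF k] by blast
qed

lemma vdist_descent_Q:
  assumes n: "6 \<le> n" and k: "k < n" and y: "y \<in> {P 0, Q 0, R 0, S 0}"
    and pos: "0 < vdist n y (Q k)"
  shows "\<exists>w. adj n w (Q k) \<and> vdist n y (Q k) = Suc (vdist n y w)"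
proof -
  let ?ok = "\<lambda>w. vdist n y (Q k) = Suc (vdist n y w)"
  have "?ok (P k) \<or> ?ok (R k) \<or> ?ok (R (prv n k))"
    using n k
  proof (cases rule: index_cases)
    case (far i j)
    then have "?ok (P k)"
      using y by (elim insertE emptyE; simp add: nxt_def prv_def dist_defs)
    then show ?thesis by blast
  next
    case (near m)
    with pos y show ?thesis
      by (elim insertE emptyE; simp add: nxt_def prv_def dist_defs split: if_splits; linarith?)
  qed
  then show ?thesis using adj_at[OF k] by blast
qed

lemma vdist_descent_R:
  assumes n: "6 \<le> n" and k: "k < n" and y: "y \<in> {P 0, Q 0, R 0, S 0}"
    and pos: "0 < vdist n y (R k)"
  shows "\<exists>w. adj n w (R k) \<and> vdist n y (R k) = Suc (vdist n y w)"
proof -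
  let ?ok = "\<lambda>w. vdist n y (R k) = Suc (vdist n y w)"
  have "?ok (Q k) \<or> ?ok (Q (nxt n k)) \<or> ?ok (S k) \<or> ?ok (S (prv n k))"
    using n k
  proof (cases rule: index_cases)
    case (far i j)
    then have "?ok (Q k) \<or> ?ok (Q (nxt n k))"
      using y by (elim insertE emptyE; simp add: nxt_def prv_def dist_defs)
    then show ?thesis by blast
  next
    case (near m)
    with pos y show ?thesis
      by (elim insertE emptyE; simp add: nxt_def prv_def dist_defs split: if_splits; linarith?)
  qed
  then show ?thesis using adj_at[OF k] by blast
qed

lemma vdist_descent_S:
  assumes n: "6 \<le> n" and k: "k < n" and y: "y \<in> {P 0, Q 0, R 0, S 0}"
    and pos: "0 < vdist n y (S k)"
  shows "\<exists>w. adj n w (S k) \<and> vdist n y (S k) = Suc (vdist n y w)"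
proof -
  let ?ok = "\<lambda>w. vdist n y (S k) = Suc (vdist n y w)"
  have "?ok (R k) \<or> ?ok (R (nxt n k))"
    using n k
  proof (cases rule: index_cases)
    case (far i j)
    then have "?ok (R k) \<or> ?ok (R (nxt n k))"
      using y by (elim insertE emptyE; simp add: nxt_def prv_def dist_defs)
    then show ?thesis by blast
  next
    case (near m)
    with pos y show ?thesis
      by (elim insertE emptyE; simp add: nxt_def prv_def dist_defs split: if_splits; linarith?)
  qed
  then show ?thesis using adj_at[OF k] by blast
qed

lemma vdist_descent:
  assumes n: "6 \<le> n" and "idx y < n" "idx v < n" "0 < vdist n y v"
  shows "\<exists>w. adj n w v \<and> vdist n y v = Suc (vdist n y w)"
proof -
  define s where "s = shift n (idx y)"
  define k where "k = idx (s v)"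
  have k: "k < n" using assms by (simp add: k_def s_def off_less)
  have sy: "s y \<in> {P 0, Q 0, R 0, S 0}" unfolding s_def by (cases y) auto
  have sv: "vdist n (s y) (s v) = vdist n y v" using vdist_shift assms by (simp add: s_def)
  have "s v = P k \<or> s v = Q k \<or> s v = R k \<or> s v = S k" unfolding k_def by (cases "s v") auto
  then obtain w where w: "adj n w (s v)" "vdist n (s y) (s v) = Suc (vdist n (s y) w)"
    using vdist_descent_P[OF n k sy] vdist_descent_Q[OF n k sy]
      vdist_descent_R[OF n k sy] vdist_descent_S[OF n k sy] assms(4) sv by metis
  \<comment> \<open>\<open>r\<close> undoes \<open>s\<close> and brings \<open>w\<close> back to a
    neighbour of \<open>v\<close>.\<close>
  define r where "r = shift n (off n (idx y) 0)"
  have j: "off n (idx y) 0 < n" using assms(1,2) by (simp add: off_less)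
  have "r (s y) = y" "r (s v) = v"
    unfolding r_def s_def using assms by (simp_all add: shift_inverse)
  then have "adj n (r w) v" "vdist n y (r w) = vdist n (s y) w"
    using adj_shift[OF j w(1)] vdist_shift[OF j, of "s y" w] adj_idx_less[OF w(1)] assms(1,2)
    by (auto simp: r_def s_def)
  then show ?thesis using w(2) sv by metis
qed

lemma graph_dist_Delta:
  assumes "6 \<le> n" "idx y < n" "idx v < n"
  shows "graph_dist (with_proj (Delta n)) y v = ereal (vdist n y v)"
proof -
  interpret pair_graph "Delta n" using pair_graph_Delta assms(1) by simp
  have V: "pverts (Delta n) = ladder_verts n"
    and A: "(u, w) \<in> parcs (Delta n) \<longleftrightarrow> adj n u w" for u w
    by (auto simp: Delta_def adj_def)
  show ?thesis
  proof (rule graph_dist_eq_potential)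
    fix e assume "e \<in> parcs (Delta n)"
    then show "vdist n y (snd e) \<le> Suc (vdist n y (fst e))"
      using vdist_adj[of n y "fst e" "snd e"] assms A[of "fst e" "snd e"] by simp
  next
    fix v assume "v \<in> pverts (Delta n)" "0 < vdist n y v"
    then obtain w where "(w, v) \<in> parcs (Delta n)" "vdist n y v = Suc (vdist n y w)"
      using vdist_descent[OF assms(1,2), of v] by (auto simp: V A)
    then show "\<exists>e\<in>parcs (Delta n). snd e = v \<and> vdist n y v = Suc (vdist n y (fst e))"
      by (intro bexI[of _ "(w, v)"]) auto
  qed (use assms V vdist_eq_0 in auto)
qed

section \<open>Three vertices suffice\<close>

text \<open>The distance to the P cycle.\<close>

fun level :: "vertex \<Rightarrow> nat" where
  "level (P i) = 0" | "level (Q i) = 1" | "level (R i) = 2" | "level (S i) = 3"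

lemma vertex_eqI: "level u = level v \<Longrightarrow> idx u = idx v \<Longrightarrow> u = v"
  by (cases u; cases v) auto

text \<open>A vertex of level \<open>l\<close> > 0 has \<open>l\<close> nearest vertices on the P
  cycle, at consecutive indices. Truncation makes \<open>level v - 1\<close> zero for P as well as
  Q, whose blocks are single indices.\<close>

lemma vdist_P: "vdist n (P i) v = level v + gap n 0 (level v - 1) (off n i (idx v))"
  by (cases v) (auto simp: numeral_eq_Suc)

text \<open>
  The coordinates \<open>x, y, z\<close> of a vertex of level \<open>l\<close> and index \<open>i\<close> relative to \<open>P 0\<close>, \<open>P 2\<close>
  and \<open>P h\<close>, where \<open>h = n div 2\<close> and \<open>e = l - 1\<close>.
\<close>

definition coords :: "nat \<Rightarrow> nat \<Rightarrow> nat \<Rightarrow> nat \<Rightarrow> nat \<Rightarrow> nat \<Rightarrow> nat \<Rightarrow> nat \<Rightarrow> bool" where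
  "coords n h l e i x y z \<longleftrightarrow>
    i = 0 \<and> x = l \<and> y + e = l + 2 \<and> z + e = l + h \<or>
    i = 1 \<and> x = l + 1 \<and> (y + e = l + 1 \<and> e \<le> 1 \<or> y = l \<and> e = 2) \<and> z + e + 1 = l + h \<or>
    2 \<le> i \<and> i + e \<le> h \<and> x = l + i \<and> y + 2 = l + i \<and> z + e + i = l + h \<or>
    2 \<le> i \<and> h < i + e \<and> i \<le> h \<and>
      (x = l + i \<and> 2 * i + e \<le> n \<or> x + e + i = l + n \<and> n \<le> 2 * i + e) \<and>
      y + 2 = l + i \<and> z = l \<or>
    h < i \<and> (x + e + i = l + n \<and> i + e \<le> n \<or> x = l \<and> i + e = n + 1) \<and>
      (y + 2 = l + i \<and> 2 * i + e \<le> n + 4 \<or> y + e + i = l + n + 2 \<and> n + 4 \<le> 2 * i + e) \<and>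
      (z + h = l + i \<and> 2 * i + e \<le> n + 2 * h \<or> z + e + i = l + n + h \<and> n + 2 * h \<le> 2 * i + e)"

lemma coords_vdist:
  assumes "6 \<le> n" "2 * h \<le> n" "n \<le> 2 * h + 1" "i < n" "e \<le> 2"
  shows "coords n h l e i (l + gap n 0 e (off n 0 i)) (l + gap n 0 e (off n 2 i))
    (l + gap n 0 e (off n h i))"
proof -
  consider "i = 0" | "i = 1" | "2 \<le> i" "i + e \<le> h" | "2 \<le> i" "h < i + e" "i \<le> h" | "h < i"
    using assms by linarith
  then show ?thesis
    using assms by cases (auto simp: coords_def off_def gap_def min_def)
qed

text \<open>Away from the ends of the two arcs between \<open>P 0\<close> and \<open>P h\<close>,
  \<open>x\<close> and \<open>z\<close> change by one per index. For even \<open>n\<close> a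
  reflection fixes \<open>P 0\<close> and \<open>P h\<close> and swaps the arcs; \<open>y\<close>
  breaks this symmetry.\<close>

lemma coords_same_level:
  assumes "6 \<le> n" "2 * h \<le> n" "n \<le> 2 * h + 1" "i < n" "j < n"
    and "coords n h l e i x y z" "coords n h l e j x y z"
    and "(l, e) \<in> {(0, 0), (1, 0), (2, 1), (3, 2)}"
  shows "i = j"
proof -
  consider "l = 0" "e = 0"
    | "l = 1" "e = 0"
    | "l = 2" "e = 1"
    | "l = 3" "e = 2"
    using assms(8) by auto
  then show ?thesis
  proof cases
    case 1
    show ?thesis
      using assms(1-7) unfolding 1 coords_def by (elim disjE conjE; linarith)
  next
    case 2
    show ?thesis
      using assms(1-7) unfolding 2 coords_def by (elim disjE conjE; linarith)
  next
    case 3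
    show ?thesis
      using assms(1-7) unfolding 3 coords_def by (elim disjE conjE; linarith)
  next
    case 4
    show ?thesis
      using assms(1-7) unfolding 4 coords_def by (elim disjE conjE; linarith)
  qed
qed

text \<open>Away from the ends of an arc, \<open>x + z\<close> is \<open>2 * l - e\<close> plus the
  arc length \<open>h\<close> or \<open>n - h\<close>, and \<open>2 * l - e\<close> is 0, 2, 3, 4 on
  the four levels. Clashes between arcs of unequal length are settled by \<open>y\<close>.\<close>

lemma coords_level_not_less:
  assumes "6 \<le> n" "2 * h \<le> n" "n \<le> 2 * h + 1" "i < n" "j < n"
    and "coords n h l e i x y z" "coords n h l' e' j x y z"
    and "(l, e) \<in> {(0, 0), (1, 0), (2, 1), (3, 2)}" "(l', e') \<in> {(0, 0), (1, 0), (2, 1), (3, 2)}"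
  shows "\<not> l < l'"
proof
  assume "l < l'"
  then consider "l = 0" "e = 0" "l' = 1" "e' = 0"
    | "l = 0" "e = 0" "l' = 2" "e' = 1"
    | "l = 0" "e = 0" "l' = 3" "e' = 2"
    | "l = 1" "e = 0" "l' = 2" "e' = 1"
    | "l = 1" "e = 0" "l' = 3" "e' = 2"
    | "l = 2" "e = 1" "l' = 3" "e' = 2"
    using assms(8,9) by (elim insertE emptyE) simp_all
  then show False
  proof cases
    case 1
    show ?thesis
      using assms(1-7) unfolding 1 coords_def by (elim disjE conjE; linarith)
  next
    case 2
    show ?thesis
      using assms(1-7) unfolding 2 coords_def by (elim disjE conjE; linarith)
  next
    case 3
    show ?thesis
      using assms(1-7) unfolding 3 coords_def by (elim disjE conjE; linarith)
  next
    case 4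
    show ?thesis
      using assms(1-7) unfolding 4 coords_def by (elim disjE conjE; linarith)
  next
    case 5
    show ?thesis
      using assms(1-7) unfolding 5 coords_def by (elim disjE conjE; linarith)
  next
    case 6
    show ?thesis
      using assms(1-7) unfolding 6 coords_def by (elim disjE conjE; linarith)
  qed
qed

lemma resolved_by_three:
  assumes "6 \<le> n" "idx u < n" "idx v < n"
    and "\<And>y. y \<in> {P 0, P 2, P (n div 2)} \<Longrightarrow> vdist n y u = vdist n y v"
  shows "u = v"
proof -
  define h where "h = n div 2"
  have h: "2 * h \<le> n" "n \<le> 2 * h + 1" unfolding h_def by auto
  have lev: "(level w, level w - 1) \<in> {(0, 0), (1, 0), (2, 1), (3, 2)}" for w
    by (cases w) auto
  have "coords n h (level w) (level w - 1) (idx w) (vdist n (P 0) w) (vdist n (P 2) w)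
    (vdist n (P h) w)" if "idx w < n" for w
    unfolding vdist_P using that by (intro coords_vdist assms(1) h) (cases w; simp)+
  \<comment> \<open>The distances of \<open>v\<close> are replaced by those of \<open>u\<close>, so
    that both carry the same triple.\<close>
  from this[OF assms(2)] this[OF assms(3)]
  have cu: "coords n h (level u) (level u - 1) (idx u) (vdist n (P 0) u) (vdist n (P 2) u)
      (vdist n (P h) u)"
    and cv: "coords n h (level v) (level v - 1) (idx v) (vdist n (P 0) u) (vdist n (P 2) u)
      (vdist n (P h) u)"
    using assms(4) unfolding h_def by simp_all
  have "level u = level v"
    using coords_level_not_less[OF assms(1) h assms(2,3) cu cv lev lev]
      coords_level_not_less[OF assms(1) h assms(3,2) cv cu lev lev] by simp
  moreover have "idx u = idx v"
    using coords_same_level[OF assms(1) h assms(2,3) cu _ lev] cv \<open>level u = level v\<close> by simp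
  ultimately show ?thesis by (rule vertex_eqI)
qed

section \<open>Two vertices do not suffice\<close>

definition unresolved :: "nat \<Rightarrow> vertex \<Rightarrow> vertex \<Rightarrow> bool" where
  "unresolved n y z \<longleftrightarrow> (\<exists>u v. idx u < n \<and> idx v < n \<and> u \<noteq> v \<and>
     vdist n y u = vdist n y v \<and> vdist n z u = vdist n z v)"

lemma unresolvedI:
  "idx u < n \<Longrightarrow> idx v < n \<Longrightarrow> u \<noteq> v \<Longrightarrow> vdist n y u = vdist n y v \<Longrightarrow>
    vdist n z u = vdist n z v \<Longrightarrow> unresolved n y z"
  unfolding unresolved_def by blast

section \<open>Unresolved pairs for each combination of types\<close>

lemma unresolved_P_P:
  assumes "6 \<le> n" "2 * b \<le> n"
  shows "unresolved n (P 0) (P b)"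
proof -
  \<comment> \<open>\<open>P (n - 2)\<close> and \<open>P 2\<close> mirror each other in the axis
    through both given vertices. In the third case both witnesses lie one step beyond
    \<open>P 0\<close> as seen from \<open>P b\<close>; in the last they lie on opposite arcs, and
    their types offset the unequal arc lengths.\<close>
  consider "b = 0"
    | "2 * b = n"
    | "0 < b \<and> 2 * b + 2 \<le> n"
    | "2 * b + 1 = n"
    using assms by linarith
  then show ?thesis
  proof cases
    case 1
    then show ?thesis using assms
      by (intro unresolvedI[of "P (n - 2)" n "P 2"]; auto simp: off_def dist_defs; linarith)
  next
    case 2
    then show ?thesis using assms
      by (intro unresolvedI[of "P (n - 2)" n "P 2"]; auto simp: off_def dist_defs; linarith)
  next
    case 3
    then show ?thesis using assms
      by (intro unresolvedI[of "P (n - 1)" n "Q 0"]; auto simp: off_def dist_defs; linarith)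
  next
    case 4
    then show ?thesis using assms
      by (intro unresolvedI[of "Q (n - 3)" n "R 2"]; auto simp: off_def dist_defs; linarith)
  qed
qed

lemma unresolved_P_Q:
  assumes "6 \<le> n" "b < n"
  shows "unresolved n (P 0) (Q b)"
proof -
  \<comment> \<open>If \<open>2 * b\<close> differs from \<open>n\<close> by one, the two S
    witnesses both stand over \<open>b\<close> and are equally far from \<open>P 0\<close> on
    opposite sides.\<close>
  consider "b = 0"
    | "2 * b = n"
    | "b = 1"
    | "2 \<le> b \<and> 2 * b + 2 \<le> n"
    | "2 * b + 1 = n"
    | "2 * b = n + 1"
    | "n + 2 \<le> 2 * b"
    using assms by linarith
  then show ?thesis
  proof cases
    case 1
    then show ?thesis using assms
      by (intro unresolvedI[of "P (n - 2)" n "P 2"]; auto simp: off_def dist_defs; linarith)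
  next
    case 2
    then show ?thesis using assms
      by (intro unresolvedI[of "P (n - 2)" n "P 2"]; auto simp: off_def dist_defs; linarith)
  next
    case 3
    then show ?thesis using assms
      by (intro unresolvedI[of "P (n - 2)" n "Q (n - 1)"]; auto simp: off_def dist_defs; linarith)
  next
    case 4
    then show ?thesis using assms
      by (intro unresolvedI[of "P (n - 1)" n "Q 0"]; auto simp: off_def dist_defs; linarith)
  next
    case 5
    then show ?thesis using assms
      by (intro unresolvedI[of "S (b - 1)" n "S b"]; auto simp: off_def dist_defs; linarith)
  next
    case 6
    then show ?thesis using assms
      by (intro unresolvedI[of "S (b - 2)" n "S (b - 1)"]; auto simp: off_def dist_defs; linarith)
  next
    case 7
    then show ?thesis using assms
      by (intro unresolvedI[of "Q (b - 1)" n "S (b - 1)"]; auto simp: off_def dist_defs; linarith)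
  qed
qed

text \<open>\<open>S b\<close> is centred over index \<open>b + 1\<close>, so
  \<open>b + 1 = n\<close> is a mirror-symmetric position. \<open>P (b + 1)\<close>,
  \<open>R (b - 1)\<close> and \<open>R (b + 2)\<close> are three steps from \<open>S b\<close>; the
  R vertex on the shorter route from \<open>P 0\<close> is taken.\<close>

lemma unresolved_P_S:
  assumes "6 \<le> n" "b < n"
  shows "unresolved n (P 0) (S b)"
proof -
  consider "b = 0"
    | "0 < b \<and> 2 * b + 2 \<le> n"
    | "n \<le> 2 * b + 1 \<and> b + 3 \<le> n"
    | "b + 2 = n"
    | "b + 1 = n"
    using assms by linarith
  then show ?thesis
  proof cases
    case 1
    then show ?thesis using assms
      by (intro unresolvedI[of "P 2" n "R (n - 1)"]; auto simp: off_def dist_defs; linarith)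
  next
    case 2
    then show ?thesis using assms
      by (intro unresolvedI[of "P (b + 1)" n "R (b - 1)"]; auto simp: off_def dist_defs; linarith)
  next
    case 3
    then show ?thesis using assms
      by (intro unresolvedI[of "P (b + 1)" n "R (b + 2)"]; auto simp: off_def dist_defs; linarith)
  next
    case 4
    then show ?thesis using assms
      by (intro unresolvedI[of "P (n - 3)" n "S 0"]; auto simp: off_def dist_defs; linarith)
  next
    case 5
    then show ?thesis using assms
      by (intro unresolvedI[of "P (n - 2)" n "P 2"]; auto simp: off_def dist_defs; linarith)
  qed
qed

text \<open>The pair \<open>Q t\<close>, \<open>S (t - 1)\<close> recurs from here on: the only
  neighbours of \<open>S (t - 1)\<close> are \<open>R (t - 1)\<close> and \<open>R t\<close>, both
  adjacent to \<open>Q t\<close>. A third vertex separates the pair only if its route to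
  \<open>Q t\<close> through \<open>P t\<close> is strictly shorter.\<close>

lemma unresolved_Q_Q:
  assumes "6 \<le> n" "2 * b \<le> n"
  shows "unresolved n (Q 0) (Q b)"
proof -
  consider "b = 0"
    | "2 * b = n"
    | "2 * b + 1 = n"
    | "b = 1"
    | "b = 2"
    | "3 \<le> b \<and> 2 * b + 2 \<le> n"
    using assms by linarith
  then show ?thesis
  proof cases
    case 1
    then show ?thesis using assms
      by (intro unresolvedI[of "P (n - 2)" n "P 2"]; auto simp: off_def dist_defs; linarith)
  next
    case 2
    then show ?thesis using assms
      by (intro unresolvedI[of "P (n - 2)" n "P 2"]; auto simp: off_def dist_defs; linarith)
  next
    case 3
    then show ?thesis using assms
      by (intro unresolvedI[of "P (n - 1)" n "Q 1"]; auto simp: off_def dist_defs; linarith)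
  next
    case 4
    then show ?thesis using assms
      by (intro unresolvedI[of "Q (n - 1)" n "S (n - 2)"]; auto simp: off_def dist_defs; linarith)
  next
    case 5
    then show ?thesis using assms
      by (intro unresolvedI[of "P (n - 1)" n "S (n - 1)"]; auto simp: off_def dist_defs; linarith)
  next
    case 6
    then show ?thesis using assms
      by (intro unresolvedI[of "Q (n - 1)" n "S (n - 1)"]; auto simp: off_def dist_defs; linarith)
  qed
qed

lemma unresolved_Q_S:
  assumes "6 \<le> n" "b < n"
  shows "unresolved n (Q 0) (S b)"
proof -
  consider "b = 0"
    | "b + 4 = n"
    | "1 \<le> b \<and> b \<le> 3"
    | "n \<le> b + 3"
    | "3 \<le> b \<and> 2 * b + 2 \<le> n"
    | "n \<le> 2 * b + 1 \<and> b + 5 \<le> n"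
    using assms by linarith
  then show ?thesis
  proof cases
    case 1
    then show ?thesis using assms
      by (intro unresolvedI[of "Q (n - 2)" n "S (n - 3)"]; auto simp: off_def dist_defs; linarith)
  next
    case 2
    then show ?thesis using assms
      by (intro unresolvedI[of "Q (n - 2)" n "S (n - 3)"]; auto simp: off_def dist_defs; linarith)
  next
    case 3
    then show ?thesis using assms
      by (intro unresolvedI[of "Q 1" n "S 0"]; auto simp: off_def dist_defs; linarith)
  next
    case 4
    then show ?thesis using assms
      by (intro unresolvedI[of "Q 1" n "S 0"]; auto simp: off_def dist_defs; linarith)
  next
    case 5
    then show ?thesis using assms
      by (intro unresolvedI[of "P (b + 1)" n "R (b - 1)"]; auto simp: off_def dist_defs; linarith)
  next
    case 6
    then show ?thesis using assms
      by (intro unresolvedI[of "P (b + 1)" n "R (b + 2)"]; auto simp: off_def dist_defs; linarith)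
  qed
qed

lemma unresolved_S_S:
  assumes "6 \<le> n" "2 * b \<le> n"
  shows "unresolved n (S 0) (S b)"
proof -
  \<comment> \<open>\<open>b = 1\<close> is set apart because \<open>S 1\<close> is itself a witness
    in the second case. From \<open>b = 5\<close> on, the detour over the P cycle from
    \<open>S b\<close> to \<open>R 2\<close> is no longer than the direct route.\<close>
  consider "b = 1"
    | "b \<noteq> 1 \<and> b \<le> 4"
    | "5 \<le> b"
    using assms by linarith
  then show ?thesis
  proof cases
    case 1
    then show ?thesis using assms
      by (intro unresolvedI[of "Q (n - 1)" n "S (n - 2)"]; auto simp: off_def dist_defs; linarith)
  next
    case 2
    then show ?thesis using assms
      by (intro unresolvedI[of "Q 2" n "S 1"]; auto simp: off_def dist_defs; linarith)
  next
    case 3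
    then show ?thesis using assms
      by (intro unresolvedI[of "P 1" n "R 2"]; auto simp: off_def dist_defs; linarith)
  qed
qed

text \<open>The reflection fixing \<open>R 0\<close> maps P index \<open>t\<close> to
  \<open>1 - t\<close> modulo \<open>n\<close>. Hence \<open>2 * b = n + 1\<close> is a symmetric
  position, and the last two cases mirror each other.\<close>

lemma unresolved_R_P:
  assumes "6 \<le> n" "b < n"
  shows "unresolved n (R 0) (P b)"
proof -
  consider "b \<le> 1"
    | "2 * b = n + 1"
    | "2 \<le> b \<and> 2 * b \<le> n"
    | "n + 2 \<le> 2 * b"
    using assms by linarith
  then show ?thesis
  proof cases
    case 1
    then show ?thesis using assms
      by (intro unresolvedI[of "S (n - 1)" n "S 0"]; auto simp: off_def dist_defs; linarith)
  next
    case 2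
    then show ?thesis using assms
      by (intro unresolvedI[of "S (n - 1)" n "S 0"]; auto simp: off_def dist_defs; linarith)
  next
    case 3
    then show ?thesis using assms
      by (intro unresolvedI[of "P 0" n "R 1"]; auto simp: off_def dist_defs; linarith)
  next
    case 4
    then show ?thesis using assms
      by (intro unresolvedI[of "P 1" n "R (n - 1)"]; auto simp: off_def dist_defs; linarith)
  qed
qed

lemma unresolved_R_Q:
  assumes "6 \<le> n" "b < n"
  shows "unresolved n (R 0) (Q b)"
proof -
  consider "b = 0"
    | "b = 1"
    | "b = 2"
    | "n \<le> b + 2"
    | "b = 3"
    | "b = 4"
    | "5 \<le> b \<and> 2 * b \<le> n"
    | "5 \<le> b \<and> 2 * b = n + 1"
    | "n + 2 \<le> 2 * b \<and> b + 3 \<le> n"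
    using assms by linarith
  then show ?thesis
  proof cases
    case 1
    then show ?thesis using assms
      by (intro unresolvedI[of "Q (n - 2)" n "S (n - 3)"]; auto simp: off_def dist_defs; linarith)
  next
    case 2
    then show ?thesis using assms
      by (intro unresolvedI[of "Q 0" n "S (n - 1)"]; auto simp: off_def dist_defs; linarith)
  next
    case 3
    then show ?thesis using assms
      by (intro unresolvedI[of "Q 0" n "S (n - 1)"]; auto simp: off_def dist_defs; linarith)
  next
    case 4
    then show ?thesis using assms
      by (intro unresolvedI[of "Q 0" n "S (n - 1)"]; auto simp: off_def dist_defs; linarith)
  next
    case 5
    then show ?thesis using assms
      by (intro unresolvedI[of "Q (b - 2)" n "S (b - 3)"]; auto simp: off_def dist_defs; linarith)
  next
    case 6
    then show ?thesis using assms
      by (intro unresolvedI[of "Q (b - 2)" n "S (b - 3)"]; auto simp: off_def dist_defs; linarith)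
  next
    case 7
    then show ?thesis using assms
      by (intro unresolvedI[of "P 0" n "R 1"]; auto simp: off_def dist_defs; linarith)
  next
    \<comment> \<open>Mirror images in the axis through \<open>R 0\<close>, which here also passes
      through \<open>Q b\<close>.\<close>
    case 8
    then show ?thesis using assms
      by (intro unresolvedI[of "P (n - 3)" n "P 4"]; auto simp: off_def dist_defs; linarith)
  next
    case 9
    then show ?thesis using assms
      by (intro unresolvedI[of "P 1" n "R (n - 1)"]; auto simp: off_def dist_defs; linarith)
  qed
qed

lemma unresolved_R_R:
  assumes "6 \<le> n" "2 * b \<le> n"
  shows "unresolved n (R 0) (R b)"
proof -
  consider "b = 0"
    | "4 \<le> b \<and> 2 * b + 1 \<le> n"
    | "1 \<le> b \<and> b \<le> 3"
    | "4 \<le> b \<and> 2 * b = n"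
    using assms by linarith
  then show ?thesis
  proof cases
    case 1
    then show ?thesis using assms
      by (intro unresolvedI[of "P 0" n "R 1"]; auto simp: off_def dist_defs; linarith)
  next
    case 2
    then show ?thesis using assms
      by (intro unresolvedI[of "P 0" n "R 1"]; auto simp: off_def dist_defs; linarith)
  next
    case 3
    then show ?thesis using assms
      by (intro unresolvedI[of "Q 3" n "S 2"]; auto simp: off_def dist_defs; linarith)
  next
    case 4
    then show ?thesis using assms
      by (intro unresolvedI[of "P (n - 3)" n "P 4"]; auto simp: off_def dist_defs; linarith)
  qed
qed

lemma unresolved_R_S:
  assumes "6 \<le> n" "b < n"
  shows "unresolved n (R 0) (S b)"
proof -
  consider "b \<le> 1"
    | "b = 2"
    | "b = 3"
    | "4 \<le> b \<and> 2 * b + 2 \<le> n"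
    | "n \<le> 2 * b + 1 \<and> b + 5 \<le> n"
    | "4 \<le> b \<and> n \<le> b + 5 \<and> b + 3 < n"
    | "4 \<le> b \<and> b + 3 = n"
    | "4 \<le> b \<and> n < b + 3"
    using assms by linarith
  then show ?thesis
  proof cases
    case 1
    then show ?thesis using assms
      by (intro unresolvedI[of "Q (b + n - 2)" n "S (b + n - 3)"]; auto simp: off_def dist_defs; linarith)
  next
    case 2
    then show ?thesis using assms
      by (intro unresolvedI[of "Q 0" n "S (n - 1)"]; auto simp: off_def dist_defs; linarith)
  next
    case 3
    then show ?thesis using assms
      by (intro unresolvedI[of "Q 1" n "S 0"]; auto simp: off_def dist_defs; linarith)
  next
    case 4
    then show ?thesis using assms
      by (intro unresolvedI[of "P 0" n "R 1"]; auto simp: off_def dist_defs; linarith)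
  next
    case 5
    then show ?thesis using assms
      by (intro unresolvedI[of "P (b + 1)" n "R (b + 2)"]; auto simp: off_def dist_defs; linarith)
  next
    \<comment> \<open>This case and the next two use one pair, \<open>Q (b + 3)\<close> and
      \<open>S (b + 2)\<close>, with indices reduced modulo \<open>n\<close>.\<close>
    case 6
    then show ?thesis using assms
      by (intro unresolvedI[of "Q (b + 3)" n "S (b + 2)"]; auto simp: off_def dist_defs; linarith)
  next
    case 7
    then show ?thesis using assms
      by (intro unresolvedI[of "Q 0" n "S (b + 2)"]; auto simp: off_def dist_defs; linarith)
  next
    case 8
    then show ?thesis using assms
      by (intro unresolvedI[of "Q (b + 3 - n)" n "S (b + 2 - n)"]; auto simp: off_def dist_defs; linarith)
  qed
qed

section \<open>Reduction of arbitrary pairs by rotation and exchange\<close>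

lemma unresolved_sym: "unresolved n y z \<Longrightarrow> unresolved n z y"
  unfolding unresolved_def by blast

lemma unresolved_shift:
  assumes "i < n" "idx y < n" "idx z < n" "unresolved n (shift n i y) (shift n i z)"
  shows "unresolved n y z"
proof -
  obtain u v where uv: "idx u < n" "idx v < n" "u \<noteq> v"
    "vdist n (shift n i y) u = vdist n (shift n i y) v"
    "vdist n (shift n i z) u = vdist n (shift n i z) v"
    using assms(4) unfolding unresolved_def by blast
  define j where "j = off n i 0"
  have j: "j < n" using assms(1) by (simp add: j_def off_less)
  have preimage: "vdist n w (shift n j x) = vdist n (shift n i w) x" if "idx w < n" "idx x < n" for w x
    using vdist_shift[OF j, of "shift n i w" x] shift_inverse[OF assms(1) that(1)] that assms(1)
    by (simp add: j_def off_less)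
  show ?thesis
    by (rule unresolvedI[of "shift n j u" n "shift n j v"])
      (use assms uv j preimage in \<open>simp_all add: off_less shift_eq_iff\<close>)
qed

lemma unresolved_two:
  assumes n: "6 \<le> n" and y: "idx y < n" and z: "idx z < n"
  shows "unresolved n y z"
proof -
  define i j where "i = idx y" and "j = idx z"
  have less: "off n i j < n" "off n j i < n"
    using y z by (simp_all add: i_def j_def off_less)
  \<comment> \<open>The offsets add up to \<open>n\<close> or both vanish. For equal types
    \<open>y\<close> and \<open>z\<close> may be exchanged, so half of the range suffices; mixed
    types come in a fixed order and are covered for every offset.\<close>
  have half: "2 * off n i j \<le> n \<or> 2 * off n j i \<le> n"
    using y z by (auto simp: i_def j_def off_def)
  have dir: "unresolved n y z" if "unresolved n (shift n i y) (shift n i z)"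
    using unresolved_shift[OF y y z] that by (simp add: i_def)
  have rev: "unresolved n y z" if "unresolved n (shift n j z) (shift n j y)"
    using unresolved_sym[OF unresolved_shift[OF z z y]] that by (simp add: j_def)
  note same = unresolved_P_P unresolved_Q_Q unresolved_R_R unresolved_S_S
  note mixed = unresolved_P_Q unresolved_P_S unresolved_Q_S unresolved_R_P unresolved_R_Q
    unresolved_R_S
  show ?thesis
    using half dir rev same[OF n, of "off n i j"] same[OF n, of "off n j i"]
      mixed[OF n less(1)] mixed[OF n less(2)]
    unfolding i_def j_def by (cases y; cases z) auto
qed

theorem theorem5:
  fixes n :: nat
  assumes "n \<ge> 6"
  shows "metric_dim (with_proj (Delta n)) = 3"
proof -
  have resolving: "resolving_set (with_proj (Delta n)) Y \<longleftrightarrow> Y \<subseteq> ladder_verts n \<and>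
      (\<forall>u v. idx u < n \<and> idx v < n \<and> u \<noteq> v \<longrightarrow> (\<exists>y\<in>Y. vdist n y u \<noteq> vdist n y v))" for Y
  proof -
    have "graph_dist (with_proj (Delta n)) y u = graph_dist (with_proj (Delta n)) y v \<longleftrightarrow>
        vdist n y u = vdist n y v"
      if "y \<in> ladder_verts n" "idx u < n" "idx v < n" for y u v
      using that graph_dist_Delta[OF assms] by simp
    then show ?thesis
      unfolding resolving_set_def by (auto simp: Delta_def) (metis mem_ladder_verts subsetD)+
  qed
  show ?thesis unfolding metric_dim_def
  proof (rule Least_equality)
    let ?Y = "{P 0, P 2, P (n div 2)}"
    have "resolving_set (with_proj (Delta n)) ?Y"
      unfolding resolving using resolved_by_three[OF assms] assms by auto
    moreover have "card ?Y = 3" using assms by (simp add: card_insert_if)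
    ultimately show "\<exists>Y. finite Y \<and> resolving_set (with_proj (Delta n)) Y \<and> card Y = 3"
      by (intro exI[of _ ?Y]) auto
  next
    fix k assume "\<exists>Y. finite Y \<and> resolving_set (with_proj (Delta n)) Y \<and> card Y = k"
    then obtain Y where Y: "finite Y" "resolving_set (with_proj (Delta n)) Y" "card Y = k"
      by blast
    show "3 \<le> k"
    proof (rule ccontr)
      assume "\<not> 3 \<le> k"
      then consider "card Y = 0" | "card Y = 1" | "card Y = 2" using Y(3) by linarith
      \<comment> \<open>\<open>y = z\<close> covers singletons; the empty set gets the default
        \<open>P 0\<close>. Enlarging \<open>Y\<close> to {\<open>y\<close>, \<open>z\<close>} is
        harmless, since an unresolved pair stays unresolved by every subset.\<close>
      then obtain y z where "Y = {} \<and> y = P 0 \<and> z = P 0 \<or> Y = {y, z}"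
        using Y(1) by cases (auto simp: card_1_singleton_iff card_2_iff)
      moreover have "idx w < n" if "w \<in> Y" for w using that Y(2) resolving by auto
      ultimately have yz: "idx y < n" "idx z < n" "Y \<subseteq> {y, z}" using assms by auto
      obtain u v where "idx u < n" "idx v < n" "u \<noteq> v" "\<forall>w\<in>{y, z}. vdist n w u = vdist n w v"
        using unresolved_two[OF assms yz(1,2)] unfolding unresolved_def by auto
      then show False using Y(2) yz(3) unfolding resolving by blast
    qed
  qed
qed

end
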